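(* Let $h>0$, $\tau>0$ be arbitrary, let $f\in L^2_{loc}([0,\infty);L^2(\Omega)^3)$, let $n\ge0$ be an integer, and let $f^{n+1}(x):=\tau^{-1}h^{-3}\int_{\tau n}^{\tau(n+1)}\int_{C_h(x)}f(t,y)\,dydt$ for $x\in\Omega_h$. Suppose that $u^n=(u^n_1,u^n_2,u^n_3):\Omega_h\to\mathbb R^3$ satisfies $\mathcal D\cdot u^n=0$ on $\Omega_h\setminus\partial\Omega_h$ and $u^n=0$ on $\partial\Omega_h$. Then there exists a unique function $u^{n+\frac12}=(u_1^{n+\frac12},u_2^{n+\frac12},u_3^{n+\frac12}):\Omega_h\to\mathbb R^3$ such that $$\frac{u_i^{n+\frac12}(x)-u_i^n(x)}\tau=-\sum_{j=1}^3\frac{u_j^n(x-he^j)D_j^+u_i^{n+\frac12}(x-he^j)+u_j^n(x)D_j^+u_i^{n+\frac12}(x)}2+\sum_{j=1}^3D_j^2u_i^{n+\frac12}(x)+f_i^{n+1}(x)$$ for all $x\in\Omega_h\setminus\partial\Omega_h$, $i=1,2,3$, and $u^{n+\frac12}(x)=0$ for all $x\in\partial\Omega_h$.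
   Context: $\Omega\subset\mathbb R^3$ is a bounded connected open set with Lipschitz boundary. For $h>0$ let $h\mathbb Z^3=\{(hz_1,hz_2,hz_3): z_i\in\mathbb Z\}$; $e^1,e^2,e^3$ is the standard basis of $\mathbb R^3$. For $B\subset h\mathbb Z^3$, $\partial B:=\{x\in B:\{x\pm he^i: i=1,2,3\}\not\subset B\}$. $C_h(x):=\prod_{i=1}^3[x_i-\frac h2,x_i+\frac h2)$ and $\Omega_h:=\{x\in\Omega\cap h\mathbb Z^3: C_{4h}(x)\subset\Omega\}$. Functions on $\Omega_h$ are always extended by $0$ outside $\Omega_h$, and $D_i^+\phi(x)=\frac{\phi(x+he^i)-\phi(x)}h$, $D_i^-\phi(x)=\frac{\phi(x)-\phi(x-he^i)}h$, $D_i^2\phi(x)=\frac{\phi(x+he^i)+\phi(x-he^i)-2\phi(x)}{h^2}$. The discrete divergence of $w:\Omega_h\to\mathbb R^3$ is $\mathcal D\cdot w=D_1^-w_1+D_2^-w_2+D_3^-w_3$. *)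

theory Defs
  imports "HOL-Analysis.Analysis"
begin

section \<open>Domains with Lipschitz boundary\<close>

text \<open>Near each boundary point the set is, in suitable orthonormal coordinates, the region
  strictly above the graph of a Lipschitz function of two variables. Translations of the
  coordinate system are absorbed into \<open>\<gamma>\<close>.\<close>

definition lipschitz_boundary :: "(real^3) set \<Rightarrow> bool" where
  "lipschitz_boundary \<Omega> \<longleftrightarrow>
     (\<forall>p\<in>frontier \<Omega>. \<exists>(T :: real^3 \<Rightarrow> real^3) r L (\<gamma> :: real^2 \<Rightarrow> real).
        orthogonal_transformation T \<and> 0 < r \<and> L-lipschitz_on UNIV \<gamma> \<and>
        \<Omega> \<inter> ball p r = {x \<in> ball p r. \<gamma> (vector [T x $ 1, T x $ 2]) < T x $ 3})"


section \<open>Square-integrable forces on the half-line\<close>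

definition L2 :: "(real^3) set \<Rightarrow> (real^3 \<Rightarrow> real^3) set" where
  "L2 \<Omega> = {g \<in> borel_measurable (lebesgue_on \<Omega>). integrable (lebesgue_on \<Omega>) (\<lambda>y. (norm (g y))\<^sup>2)}"

definition L2_norm :: "(real^3) set \<Rightarrow> (real^3 \<Rightarrow> real^3) \<Rightarrow> real" where
  "L2_norm \<Omega> g = sqrt (\<integral>y. (norm (g y))\<^sup>2 \<partial>lebesgue_on \<Omega>)"

definition simple_L2 :: "(real^3) set \<Rightarrow> (real \<Rightarrow> real^3 \<Rightarrow> real^3) \<Rightarrow> bool" where
  "simple_L2 \<Omega> s \<longleftrightarrow>
     finite (s ` {0..}) \<and> s ` {0..} \<subseteq> L2 \<Omega> \<and> (\<forall>g. {t\<in>{0..}. s t = g} \<in> sets lebesgue)"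

text \<open>Elements are represented by functions \<open>f t y\<close> rather than by equivalence classes, so that
  \<open>f t\<close> need only be in \<open>L2 \<Omega>\<close> for almost every \<open>t\<close>. Measurability in \<open>t\<close> is strong (Bochner)
  measurability: almost everywhere approximation, in the norm of \<open>L2 \<Omega>\<close>, by simple functions.\<close>

definition L2loc_L2 :: "(real^3) set \<Rightarrow> (real \<Rightarrow> real^3 \<Rightarrow> real^3) set" where
  "L2loc_L2 \<Omega> = {f.
     (AE t in lebesgue_on {0..}. f t \<in> L2 \<Omega>) \<and>
     (\<exists>s. (\<forall>k. simple_L2 \<Omega> (s k)) \<and>
        (AE t in lebesgue_on {0..}. (\<lambda>k::nat. L2_norm \<Omega> (\<lambda>y. s k t y - f t y)) \<longlonglongrightarrow> 0)) \<and>
     (\<forall>T>0. integrable (lebesgue_on {0..T}) (\<lambda>t. (L2_norm \<Omega> (f t))\<^sup>2))}"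


section \<open>Grids\<close>

definition grid :: "real \<Rightarrow> (real^3) set" where
  "grid h = {x. \<forall>i. \<exists>z::int. x $ i = h * of_int z}"

definition grid_boundary :: "real \<Rightarrow> (real^3) set \<Rightarrow> (real^3) set" where
  "grid_boundary h B =
     {x \<in> B. \<not> (\<Union>i. {x + h *\<^sub>R axis i 1, x - h *\<^sub>R axis i 1}) \<subseteq> B}"

definition cell :: "real \<Rightarrow> real^3 \<Rightarrow> (real^3) set" where
  "cell h x = {y. \<forall>i. x $ i - h / 2 \<le> y $ i \<and> y $ i < x $ i + h / 2}"

definition grid_domain :: "(real^3) set \<Rightarrow> real \<Rightarrow> (real^3) set" where
  "grid_domain \<Omega> h = {x \<in> \<Omega> \<inter> grid h. cell (4 * h) x \<subseteq> \<Omega>}"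

text \<open>A function on the grid domain is identified with its extension by zero, so that an equality
  of such functions is an equality on the grid domain.\<close>

definition grid_functions :: "(real^3) set \<Rightarrow> real \<Rightarrow> (real^3 \<Rightarrow> real^3) set" where
  "grid_functions \<Omega> h = {u. \<forall>x. x \<notin> grid_domain \<Omega> h \<longrightarrow> u x = 0}"


section \<open>Difference operators\<close>

definition D_plus :: "real \<Rightarrow> 3 \<Rightarrow> (real^3 \<Rightarrow> real) \<Rightarrow> real^3 \<Rightarrow> real" where
  "D_plus h i \<phi> x = (\<phi> (x + h *\<^sub>R axis i 1) - \<phi> x) / h"

definition D_minus :: "real \<Rightarrow> 3 \<Rightarrow> (real^3 \<Rightarrow> real) \<Rightarrow> real^3 \<Rightarrow> real" where
  "D_minus h i \<phi> x = (\<phi> x - \<phi> (x - h *\<^sub>R axis i 1)) / h"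

definition D_second :: "real \<Rightarrow> 3 \<Rightarrow> (real^3 \<Rightarrow> real) \<Rightarrow> real^3 \<Rightarrow> real" where
  "D_second h i \<phi> x =
     (\<phi> (x + h *\<^sub>R axis i 1) + \<phi> (x - h *\<^sub>R axis i 1) - 2 * \<phi> x) / h\<^sup>2"

definition discrete_div :: "real \<Rightarrow> (real^3 \<Rightarrow> real^3) \<Rightarrow> real^3 \<Rightarrow> real" where
  "discrete_div h w x = (\<Sum>j\<in>UNIV. D_minus h j (\<lambda>y. w y $ j) x)"

definition averaged_force ::
    "real \<Rightarrow> real \<Rightarrow> (real \<Rightarrow> real^3 \<Rightarrow> real^3) \<Rightarrow> nat \<Rightarrow> real^3 \<Rightarrow> real^3" where
  "averaged_force h \<tau> f n x =
     (1 / (\<tau> * h ^ 3)) *\<^sub>R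
       (LINT t:{\<tau> * real n..\<tau> * real (n + 1)}|lebesgue. (LINT y:cell h x|lebesgue. f t y))"

end

theory Submission
  imports Defs
begin

text \<open>The scheme is one linear system per component of \<open>v\<close>, with as many equations as unknowns
  (the values at the interior grid points), so that it suffices to see that the homogeneous system
  has only the trivial solution. Testing it with the solution \<open>\<phi>\<close> itself and summing by parts,
  the discrete Laplacian contributes with a sign, and the symmetrised convection term reduces to
  \<open>- (\<Sum>x. div u x * (\<phi> x)\<^sup>2) / 2\<close>, which vanishes because \<open>u\<close> is discretely divergence
  free; what remains is \<open>(\<Sum>x. (\<phi> x)\<^sup>2) / \<tau> \<le> 0\<close>.\<close>

section \<open>Finite linear systems over a field\<close>

text \<open>Gaussian elimination, by induction on the number of equations: an equation without
  nonzero coefficient is dropped, any other one removes an unknown together with itself, so the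
  surplus of unknowns persists.\<close>

lemma underdetermined_system_nontrivial:
  fixes a :: "'r \<Rightarrow> 'c \<Rightarrow> 'k::field"
  assumes "finite R" "finite C" "card R < card C"
  shows "\<exists>x. (\<exists>c\<in>C. x c \<noteq> 0) \<and> (\<forall>r\<in>R. (\<Sum>c\<in>C. a r c * x c) = 0)"
  using assms
proof (induction R arbitrary: a C rule: finite_induct)
  case empty
  then show ?case by (intro exI[of _ "\<lambda>_. 1"]) (auto simp: card_gt_0_iff)
next
  case (insert r R)
  show ?case
  proof (cases "\<forall>c\<in>C. a r c = 0")
    case True
    from insert.IH[of C a] insert.prems insert.hyps obtain x where
      "\<exists>c\<in>C. x c \<noteq> 0" "\<forall>r\<in>R. (\<Sum>c\<in>C. a r c * x c) = 0" by auto
    with True show ?thesis by (intro exI[of _ x]) auto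
  next
    case False
    then obtain c0 where c0: "c0 \<in> C" "a r c0 \<noteq> 0" by blast
    define C' where "C' = C - {c0}"
    have C': "finite C'" "c0 \<notin> C'" "C = insert c0 C'" "card R < card C'"
      using insert.prems insert.hyps c0 by (auto simp: C'_def)
    \<comment> \<open>The reduced row \<open>s\<close> is row \<open>s\<close> minus the multiple of
      row \<open>r\<close> that cancels the coefficient of \<open>c0\<close>.\<close>
    obtain x where x: "\<exists>c\<in>C'. x c \<noteq> 0"
      "\<forall>s\<in>R. (\<Sum>c\<in>C'. (a s c - a s c0 / a r c0 * a r c) * x c) = 0"
      using insert.IH[OF C'(1,4), of "\<lambda>s c. a s c - a s c0 / a r c0 * a r c"] by blast
    \<comment> \<open>The value of the unknown \<open>c0\<close> forced by equation \<open>r\<close>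
      once the other unknowns are given by \<open>x\<close>.\<close>
    define t where "t = - (\<Sum>c\<in>C'. a r c * x c) / a r c0"
    define y where "y = x(c0 := t)"
    have y: "(\<Sum>c\<in>C. a s c * y c) = a s c0 * t + (\<Sum>c\<in>C'. a s c * x c)" for s
    proof -
      have "(\<Sum>c\<in>C'. a s c * y c) = (\<Sum>c\<in>C'. a s c * x c)"
        using C'(2) by (intro sum.cong) (auto simp: y_def)
      then show ?thesis using C' by (simp add: y_def)
    qed
    have "(\<Sum>c\<in>C. a s c * y c) = 0" if "s \<in> insert r R" for s
    proof (cases "s = r")
      case True
      then show ?thesis using c0 by (simp add: y t_def)
    next
      case False
      with that x(2) have "0 = (\<Sum>c\<in>C'. (a s c - a s c0 / a r c0 * a r c) * x c)" by simp
      also have "\<dots> = (\<Sum>c\<in>C'. a s c * x c) - a s c0 / a r c0 * (\<Sum>c\<in>C'. a r c * x c)"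
        by (simp add: left_diff_distrib sum_subtractf sum_distrib_left mult.assoc)
      finally show ?thesis by (simp add: y t_def)
    qed
    moreover have "\<exists>c\<in>C. y c \<noteq> 0" using x(1) C' by (auto simp: y_def)
    ultimately show ?thesis by blast
  qed
qed

text \<open>Homogenisation: with the right-hand side adjoined as one more column there are more
  unknowns than equations, hence a nontrivial solution. Its extra entry is nonzero, since otherwise
  injectivity would force all other entries to vanish; dividing by it gives the solution.\<close>

lemma square_system_solvable:
  fixes a :: "'a \<Rightarrow> 'a \<Rightarrow> 'k::field"
  assumes fin: "finite S"
    and inj: "\<And>x. \<forall>r\<in>S. (\<Sum>c\<in>S. a r c * x c) = 0 \<Longrightarrow> \<forall>c\<in>S. x c = 0"
  shows "\<exists>x. \<forall>r\<in>S. (\<Sum>c\<in>S. a r c * x c) = b r"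
proof -
  \<comment> \<open>\<open>None\<close> indexes the additional unknown, whose column is
    \<open>- b\<close>.\<close>
  define a' where "a' r c = (case c of None \<Rightarrow> - b r | Some c \<Rightarrow> a r c)" for r c
  have "card S < card (insert None (Some ` S))"
    using fin by (simp add: card_image)
  then obtain z where z: "\<exists>c\<in>insert None (Some ` S). z c \<noteq> 0"
    "\<forall>r\<in>S. (\<Sum>c\<in>insert None (Some ` S). a' r c * z c) = 0"
    using underdetermined_system_nontrivial[OF fin, of "insert None (Some ` S)" a'] fin by auto
  have eq: "(\<Sum>c\<in>S. a r c * z (Some c)) = b r * z None" if "r \<in> S" for r
    using z(2)[rule_format, OF that] fin by (simp add: a'_def sum.reindex)
  have "z None \<noteq> 0"
  proof
    assume "z None = 0"
    with inj[of "\<lambda>c. z (Some c)"] eq z(1) show False by auto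
  qed
  with eq show ?thesis
    by (intro exI[of _ "\<lambda>c. z (Some c) / z None"])
      (simp add: sum_divide_distrib[symmetric] divide_simps)
qed

text \<open>Lets a linear operator be inverted on functions supported in \<open>S\<close> without
  writing out its matrix: the values on \<open>S\<close> are the unknowns, and the equations are
  imposed on \<open>S\<close> only.\<close>

lemma linear_operator_solvable:
  fixes L :: "('a \<Rightarrow> 'k::field) \<Rightarrow> 'a \<Rightarrow> 'k"
  assumes fin: "finite S"
    and add: "\<And>\<phi> \<psi> x. L (\<lambda>y. \<phi> y + \<psi> y) x = L \<phi> x + L \<psi> x"
    and scale: "\<And>c \<phi> x. L (\<lambda>y. c * \<phi> y) x = c * L \<phi> x"
    and inj: "\<And>\<phi>. (\<And>x. x \<notin> S \<Longrightarrow> \<phi> x = 0) \<Longrightarrow> (\<And>x. x \<in> S \<Longrightarrow> L \<phi> x = 0) \<Longrightarrow> \<forall>x\<in>S. \<phi> x = 0"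
  shows "\<exists>\<phi>. (\<forall>x. x \<notin> S \<longrightarrow> \<phi> x = 0) \<and> (\<forall>x\<in>S. L \<phi> x = b x)"
proof -
  \<comment> \<open>Unit functions; the matrix of the operator has the entry
    \<open>L (\<delta> s) x\<close> in row \<open>x\<close> and column \<open>s\<close>.\<close>
  define \<delta> :: "'a \<Rightarrow> 'a \<Rightarrow> 'k" where "\<delta> s y = (if y = s then 1 else 0)" for s y
  have L_sum: "L (\<lambda>y. \<Sum>s\<in>T. \<phi> s * \<delta> s y) x = (\<Sum>s\<in>T. L (\<delta> s) x * \<phi> s)"
    if "finite T" for T \<phi> x
    using that
  proof (induction T rule: finite_induct)
    case empty
    show ?case using scale[of 0 "\<lambda>_. 0" x] by simp
  next
    case (insert t T)
    then show ?case by (simp add: add scale mult.commute)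
  qed
  have sum_\<delta>: "(\<Sum>s\<in>S. \<phi> s * \<delta> s y) = (if y \<in> S then \<phi> y else 0)" for \<phi> y
    using fin by (simp add: \<delta>_def if_distrib[of "\<lambda>t. _ * t"] cong: if_cong)
  have L_matrix: "L (\<lambda>y. if y \<in> S then \<phi> y else 0) x = (\<Sum>s\<in>S. L (\<delta> s) x * \<phi> s)" for \<phi> x
    using L_sum[OF fin, of \<phi> x] by (simp add: sum_\<delta>)
  have "\<exists>\<phi>. \<forall>x\<in>S. (\<Sum>s\<in>S. L (\<delta> s) x * \<phi> s) = b x"
  proof (rule square_system_solvable[OF fin])
    fix \<phi> assume "\<forall>x\<in>S. (\<Sum>s\<in>S. L (\<delta> s) x * \<phi> s) = 0"
    then show "\<forall>x\<in>S. \<phi> x = 0"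
      using inj[of "\<lambda>y. if y \<in> S then \<phi> y else 0"] by (simp add: L_matrix)
  qed
  then obtain \<phi> where "\<forall>x\<in>S. (\<Sum>s\<in>S. L (\<delta> s) x * \<phi> s) = b x" by blast
  then show ?thesis
    by (intro exI[of _ "\<lambda>y. if y \<in> S then \<phi> y else 0"]) (simp add: L_matrix)
qed

section \<open>Summation by parts for functions supported in a finite set\<close>

text \<open>\<open>p\<close> lives on the pairs \<open>x\<close>, \<open>x + e\<close> with both
  ends in \<open>S\<close>; the two sums index such a pair by its upper and by its lower end, so no
  boundary terms arise.\<close>

lemma sum_shift:
  fixes e :: "'a::ab_group_add" and p :: "'a \<Rightarrow> 'b::comm_monoid_add"
  assumes "finite S" and "\<And>x. x \<notin> S \<or> x + e \<notin> S \<Longrightarrow> p x = 0"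
  shows "(\<Sum>x\<in>S. p (x - e)) = (\<Sum>x\<in>S. p x)"
proof -
  have "(\<Sum>x\<in>S. p (x - e)) = (\<Sum>x\<in>{x\<in>S. x - e \<in> S}. p (x - e))"
    using assms by (intro sum.mono_neutral_right) auto
  also have "\<dots> = (\<Sum>x\<in>{x\<in>S. x + e \<in> S}. p x)"
    by (intro sum.reindex_bij_witness[of _ "\<lambda>x. x + e" "\<lambda>x. x - e"]) auto
  also have "\<dots> = (\<Sum>x\<in>S. p x)"
    using assms by (intro sum.mono_neutral_left) auto
  finally show ?thesis .
qed

text \<open>Only an inequality: the shifted sum misses the values of \<open>q\<close> at those
  points \<open>y\<close> of \<open>S\<close> for which \<open>y - e\<close> is outside
  \<open>S\<close>.\<close>

lemma sum_shift_le:
  fixes e :: "'a::ab_group_add" and q :: "'a \<Rightarrow> real"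
  assumes "finite S" and "\<And>x. x \<notin> S \<Longrightarrow> q x = 0" and "\<And>x. 0 \<le> q x"
  shows "(\<Sum>x\<in>S. q (x + e)) \<le> (\<Sum>x\<in>S. q x)"
proof -
  have "(\<Sum>x\<in>S. q (x + e)) = (\<Sum>x\<in>{x\<in>S. x + e \<in> S}. q (x + e))"
    using assms by (intro sum.mono_neutral_right) auto
  also have "\<dots> = (\<Sum>x\<in>{x\<in>S. x - e \<in> S}. q x)"
    by (intro sum.reindex_bij_witness[of _ "\<lambda>x. x - e" "\<lambda>x. x + e"]) auto
  also have "\<dots> \<le> (\<Sum>x\<in>S. q x)"
    using assms by (intro sum_mono2) auto
  finally show ?thesis .
qed

lemma sum_mult_shift_le_sum_squares:
  fixes e :: "'a::ab_group_add" and \<phi> :: "'a \<Rightarrow> real"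
  assumes "finite S" and "\<And>x. x \<notin> S \<Longrightarrow> \<phi> x = 0"
  shows "(\<Sum>x\<in>S. \<phi> x * \<phi> (x + e)) \<le> (\<Sum>x\<in>S. (\<phi> x)\<^sup>2)"
proof -
  have "2 * (\<Sum>x\<in>S. \<phi> x * \<phi> (x + e)) \<le> (\<Sum>x\<in>S. (\<phi> x)\<^sup>2 + (\<phi> (x + e))\<^sup>2)"
    unfolding sum_distrib_left
  proof (rule sum_mono)
    fix x
    show "2 * (\<phi> x * \<phi> (x + e)) \<le> (\<phi> x)\<^sup>2 + (\<phi> (x + e))\<^sup>2"
      using sum_squares_bound[of "\<phi> x" "\<phi> (x + e)"] by simp
  qed
  also have "\<dots> \<le> 2 * (\<Sum>x\<in>S. (\<phi> x)\<^sup>2)"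
    using sum_shift_le[OF assms(1), where q = "\<lambda>x. (\<phi> x)\<^sup>2" and e = e] assms(2) by (simp add: sum.distrib)
  finally show ?thesis by simp
qed

text \<open>Up to the factor \<open>h\<^sup>2\<close>, the sum consists of two cross terms, which
  are equal after a shift, minus twice the sum of squares; each cross term is at most that sum of
  squares.\<close>

lemma sum_mult_D_second_nonpos:
  fixes \<phi> :: "real^3 \<Rightarrow> real"
  assumes "finite S" and "\<And>x. x \<notin> S \<Longrightarrow> \<phi> x = 0"
  shows "(\<Sum>x\<in>S. \<phi> x * D_second h j \<phi> x) \<le> 0"
proof -
  define e :: "real^3" where "e = h *\<^sub>R axis j 1"
  have shift: "(\<Sum>x\<in>S. \<phi> x * \<phi> (x - e)) = (\<Sum>x\<in>S. \<phi> x * \<phi> (x + e))"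
    using sum_shift[OF assms(1), where e = e and p = "\<lambda>x. \<phi> x * \<phi> (x + e)"] assms(2)
    by (auto simp: mult.commute)
  have "(\<Sum>x\<in>S. \<phi> x * D_second h j \<phi> x)
      = (\<Sum>x\<in>S. (\<phi> x * \<phi> (x + e) + \<phi> x * \<phi> (x - e) - 2 * (\<phi> x)\<^sup>2) / h\<^sup>2)"
    by (simp add: D_second_def e_def algebra_simps power2_eq_square)
  also have "\<dots> = ((\<Sum>x\<in>S. \<phi> x * \<phi> (x + e)) + (\<Sum>x\<in>S. \<phi> x * \<phi> (x - e))
      - 2 * (\<Sum>x\<in>S. (\<phi> x)\<^sup>2)) / h\<^sup>2"
    by (simp add: sum_divide_distrib[symmetric] sum.distrib sum_subtractf sum_distrib_left)
  also have "\<dots> \<le> 0"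
    using sum_mult_shift_le_sum_squares[where \<phi> = \<phi> and e = e, OF assms] by (simp add: shift divide_nonpos_nonneg)
  finally show ?thesis .
qed

text \<open>Averaging the two differences makes the products of \<open>\<phi>\<close> at
  neighbouring points telescope; what is left are the squares, weighted by the difference of
  \<open>a\<close>.\<close>

lemma sum_mult_convection:
  fixes a \<phi> :: "real^3 \<Rightarrow> real"
  assumes "finite S" and "\<And>x. x \<notin> S \<Longrightarrow> \<phi> x = 0"
  shows "(\<Sum>x\<in>S. \<phi> x * ((a (x - h *\<^sub>R axis j 1) * D_plus h j \<phi> (x - h *\<^sub>R axis j 1)
            + a x * D_plus h j \<phi> x) / 2))
       = - (\<Sum>x\<in>S. D_minus h j a x * (\<phi> x)\<^sup>2) / 2"
proof -
  define e :: "real^3" where "e = h *\<^sub>R axis j 1"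
  \<comment> \<open>The contribution of the edge from \<open>x\<close> to \<open>x + e\<close>. It
    contains \<open>\<phi>\<close> at both ends, so it vanishes unless both lie in \<open>S\<close>,
    as \<open>sum_shift\<close> demands.\<close>
  define p where "p x = a x * \<phi> x * \<phi> (x + e) / (2 * h)" for x
  have "(\<Sum>x\<in>S. \<phi> x * ((a (x - e) * D_plus h j \<phi> (x - e) + a x * D_plus h j \<phi> x) / 2))
      = (\<Sum>x\<in>S. - (D_minus h j a x * (\<phi> x)\<^sup>2) / 2 + p x - p (x - e))"
    by (intro sum.cong refl)
      (simp add: D_plus_def D_minus_def p_def e_def[symmetric] diff_divide_distrib
        add_divide_distrib power2_eq_square algebra_simps)
  also have "\<dots> = - (\<Sum>x\<in>S. D_minus h j a x * (\<phi> x)\<^sup>2) / 2 + (\<Sum>x\<in>S. p x) - (\<Sum>x\<in>S. p (x - e))"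
    by (simp add: sum.distrib sum_subtractf sum_divide_distrib sum_negf)
  also have "(\<Sum>x\<in>S. p (x - e)) = (\<Sum>x\<in>S. p x)"
    using assms by (intro sum_shift) (auto simp: p_def)
  finally show ?thesis by (simp add: e_def)
qed

section \<open>The discrete scheme as a linear operator\<close>

text \<open>The coordinates of a grid point are integer multiples of \<open>h\<close>, and a bound
  \<open>B\<close> on the norm restricts the integers to absolute value at most
  \<open>B / h\<close>.\<close>

lemma finite_grid_domain:
  assumes "bounded \<Omega>" and "h > 0"
  shows "finite (grid_domain \<Omega> h)"
proof -
  obtain B where B: "\<And>x. x \<in> \<Omega> \<Longrightarrow> norm x \<le> B"
    using assms(1) by (auto simp: bounded_iff)
  define N where "N = \<lceil>B / h\<rceil>"
  have "grid_domain \<Omega> h \<subseteq> (\<lambda>z. \<chi> i. h * of_int (z i)) ` (UNIV \<rightarrow> {-N..N})"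
  proof
    fix x assume x: "x \<in> grid_domain \<Omega> h"
    then obtain z :: "3 \<Rightarrow> int" where z: "\<And>i. x $ i = h * of_int (z i)"
      unfolding grid_domain_def grid_def by simp metis
    have "z i \<in> {-N..N}" for i
    proof -
      have "\<bar>x $ i\<bar> \<le> B"
        using component_le_norm_cart[of x i] B[of x] x by (auto simp: grid_domain_def)
      then have "\<bar>real_of_int (z i)\<bar> \<le> B / h"
        using assms(2) by (simp add: z abs_mult field_simps)
      then show ?thesis by (simp add: N_def) linarith
    qed
    then show "x \<in> (\<lambda>z. \<chi> i. h * of_int (z i)) ` (UNIV \<rightarrow> {-N..N})"
      by (intro image_eqI[of _ _ z]) (auto simp: vec_eq_iff z)
  qed
  moreover have "finite ((UNIV :: 3 set) \<rightarrow> {-N..N})"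
    using finite_PiE[of "UNIV :: 3 set" "\<lambda>_. {-N..N}"] by (simp add: PiE_UNIV_domain)
  ultimately show ?thesis by (rule finite_subset[OF _ finite_imageI])
qed

text \<open>The part of the scheme that contains the new velocity, for one component
  \<open>\<phi>\<close>. The old velocity \<open>u\<close> is frozen in the convection term, so it
  is linear in \<open>\<phi>\<close>, and the same operator serves all three components.\<close>

definition step_operator ::
    "real \<Rightarrow> real \<Rightarrow> (real^3 \<Rightarrow> real^3) \<Rightarrow> (real^3 \<Rightarrow> real) \<Rightarrow> real^3 \<Rightarrow> real" where
  "step_operator h \<tau> u \<phi> x =
     \<phi> x / \<tau>
     + (\<Sum>j\<in>UNIV. (u (x - h *\<^sub>R axis j 1) $ j * D_plus h j \<phi> (x - h *\<^sub>R axis j 1)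
                    + u x $ j * D_plus h j \<phi> x) / 2)
     - (\<Sum>j\<in>UNIV. D_second h j \<phi> x)"

lemma step_operator_add:
  "step_operator h \<tau> u (\<lambda>y. \<phi> y + \<psi> y) x = step_operator h \<tau> u \<phi> x + step_operator h \<tau> u \<psi> x"
proof -
  have plus: "D_plus h j (\<lambda>y. \<phi> y + \<psi> y) y = D_plus h j \<phi> y + D_plus h j \<psi> y" for j y
    by (simp add: D_plus_def diff_divide_distrib add_divide_distrib)
  have second: "D_second h j (\<lambda>y. \<phi> y + \<psi> y) y = D_second h j \<phi> y + D_second h j \<psi> y" for j y
    by (simp add: D_second_def diff_divide_distrib add_divide_distrib)
  show ?thesis
    by (simp add: step_operator_def plus second sum.distrib distrib_left add_divide_distrib)
qed

lemma step_operator_scale: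
  "step_operator h \<tau> u (\<lambda>y. c * \<phi> y) x = c * step_operator h \<tau> u \<phi> x"
proof -
  have plus: "D_plus h j (\<lambda>y. c * \<phi> y) y = c * D_plus h j \<phi> y" for j y
    by (simp add: D_plus_def right_diff_distrib)
  have second: "D_second h j (\<lambda>y. c * \<phi> y) y = c * D_second h j \<phi> y" for j y
    by (simp add: D_second_def algebra_simps)
  show ?thesis
    by (simp add: step_operator_def plus second sum_distrib_left algebra_simps)
qed

lemma step_operator_diff:
  "step_operator h \<tau> u (\<lambda>y. \<phi> y - \<psi> y) x = step_operator h \<tau> u \<phi> x - step_operator h \<tau> u \<psi> x"
  using step_operator_add[of h \<tau> u \<phi> "\<lambda>y. - 1 * \<psi> y" x]
  unfolding step_operator_scale by simp

text \<open>The discrete energy estimate: the time derivative yields the left-hand side, convection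
  yields zero and diffusion a nonnegative contribution.\<close>

lemma step_operator_coercive:
  assumes "finite S" and "\<And>x. x \<notin> S \<Longrightarrow> \<phi> x = 0"
    and div: "\<And>x. x \<in> S \<Longrightarrow> discrete_div h u x = 0"
  shows "(\<Sum>x\<in>S. (\<phi> x)\<^sup>2) / \<tau> \<le> (\<Sum>x\<in>S. \<phi> x * step_operator h \<tau> u \<phi> x)"
proof -
  define conv where "conv j x = (u (x - h *\<^sub>R axis j 1) $ j * D_plus h j \<phi> (x - h *\<^sub>R axis j 1)
    + u x $ j * D_plus h j \<phi> x) / 2" for j x
  have step: "step_operator h \<tau> u \<phi> x
      = \<phi> x / \<tau> + (\<Sum>j\<in>UNIV. conv j x) - (\<Sum>j\<in>UNIV. D_second h j \<phi> x)" for x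
    by (simp only: step_operator_def conv_def)
  have "(\<Sum>x\<in>S. \<phi> x * step_operator h \<tau> u \<phi> x)
      = (\<Sum>x\<in>S. (\<phi> x)\<^sup>2 / \<tau> + (\<Sum>j\<in>UNIV. \<phi> x * conv j x) - (\<Sum>j\<in>UNIV. \<phi> x * D_second h j \<phi> x))"
    by (simp add: step sum_distrib_left[symmetric] power2_eq_square algebra_simps)
  also have "\<dots> = (\<Sum>x\<in>S. (\<phi> x)\<^sup>2) / \<tau> + (\<Sum>x\<in>S. \<Sum>j\<in>UNIV. \<phi> x * conv j x)
      - (\<Sum>x\<in>S. \<Sum>j\<in>UNIV. \<phi> x * D_second h j \<phi> x)"
    by (simp add: sum.distrib sum_subtractf sum_divide_distrib)
  also have "(\<Sum>x\<in>S. \<Sum>j\<in>UNIV. \<phi> x * conv j x) = (\<Sum>j\<in>UNIV. \<Sum>x\<in>S. \<phi> x * conv j x)"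
    by (rule sum.swap)
  also have "(\<Sum>j\<in>UNIV. \<Sum>x\<in>S. \<phi> x * conv j x)
      = (\<Sum>j\<in>UNIV. - (\<Sum>x\<in>S. D_minus h j (\<lambda>y. u y $ j) x * (\<phi> x)\<^sup>2) / 2)"
    unfolding conv_def by (intro sum.cong refl sum_mult_convection assms)
  also have "\<dots> = - (\<Sum>j\<in>UNIV. \<Sum>x\<in>S. D_minus h j (\<lambda>y. u y $ j) x * (\<phi> x)\<^sup>2) / 2"
    by (simp add: sum_negf sum_divide_distrib)
  \<comment> \<open>The cancellation comes from the sum over all directions: at each point the
    differences add up to the discrete divergence.\<close>
  also have "(\<Sum>j\<in>UNIV. \<Sum>x\<in>S. D_minus h j (\<lambda>y. u y $ j) x * (\<phi> x)\<^sup>2)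
      = (\<Sum>x\<in>S. discrete_div h u x * (\<phi> x)\<^sup>2)"
    unfolding discrete_div_def sum_distrib_right by (rule sum.swap)
  also have "(\<Sum>x\<in>S. discrete_div h u x * (\<phi> x)\<^sup>2) = 0"
    by (simp add: div)
  also have "(\<Sum>x\<in>S. \<Sum>j\<in>UNIV. \<phi> x * D_second h j \<phi> x)
      = (\<Sum>j\<in>UNIV. \<Sum>x\<in>S. \<phi> x * D_second h j \<phi> x)"
    by (rule sum.swap)
  finally show ?thesis
    using sum_nonpos[of UNIV "\<lambda>j. \<Sum>x\<in>S. \<phi> x * D_second h j \<phi> x"]
      sum_mult_D_second_nonpos[where \<phi> = \<phi> and h = h, OF assms(1,2)] by simp
qed

lemma step_operator_injective:
  assumes "finite S" and "\<And>x. x \<notin> S \<Longrightarrow> \<phi> x = 0" and "\<tau> > 0"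
    and "\<And>x. x \<in> S \<Longrightarrow> discrete_div h u x = 0"
    and "\<And>x. x \<in> S \<Longrightarrow> step_operator h \<tau> u \<phi> x = 0"
  shows "\<phi> x = 0"
proof -
  have "(\<Sum>x\<in>S. (\<phi> x)\<^sup>2) \<le> 0"
    using step_operator_coercive[of S \<phi> h u \<tau>] assms by (simp add: divide_le_0_iff)
  then have "(\<Sum>x\<in>S. (\<phi> x)\<^sup>2) = 0"
    by (intro antisym sum_nonneg) auto
  then show ?thesis
    using assms(1,2) by (cases "x \<in> S") (auto simp: sum_nonneg_eq_0_iff)
qed

theorem theorem3p1:
  fixes \<Omega> :: "(real^3) set" and h \<tau> :: real and n :: nat
    and f :: "real \<Rightarrow> real^3 \<Rightarrow> real^3" and u :: "real^3 \<Rightarrow> real^3"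
  assumes "bounded \<Omega>" and "connected \<Omega>" and "open \<Omega>" and "lipschitz_boundary \<Omega>"
    and "h > 0" and "\<tau> > 0"
    and "f \<in> L2loc_L2 \<Omega>"
    and "u \<in> grid_functions \<Omega> h"
    and "\<forall>x \<in> grid_domain \<Omega> h - grid_boundary h (grid_domain \<Omega> h). discrete_div h u x = 0"
    and "\<forall>x \<in> grid_boundary h (grid_domain \<Omega> h). u x = 0"
  shows "\<exists>!v. v \<in> grid_functions \<Omega> h \<and>
    (\<forall>x \<in> grid_domain \<Omega> h - grid_boundary h (grid_domain \<Omega> h). \<forall>i::3.
       (v x $ i - u x $ i) / \<tau> =
         - (\<Sum>j\<in>UNIV. (u (x - h *\<^sub>R axis j 1) $ j * D_plus h j (\<lambda>y. v y $ i) (x - h *\<^sub>R axis j 1)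
                         + u x $ j * D_plus h j (\<lambda>y. v y $ i) x) / 2)
         + (\<Sum>j\<in>UNIV. D_second h j (\<lambda>y. v y $ i) x)
         + averaged_force h \<tau> f n x $ i) \<and>
    (\<forall>x \<in> grid_boundary h (grid_domain \<Omega> h). v x = 0)"
proof -
  let ?G = "grid_domain \<Omega> h"
  \<comment> \<open>The interior points carry both the unknowns and the equations, which makes the
    system square; \<open>b\<close> collects the data.\<close>
  define S where "S = ?G - grid_boundary h ?G"
  define b where "b i x = u x $ i / \<tau> + averaged_force h \<tau> f n x $ i" for i x
  have fin: "finite S"
    using finite_grid_domain[OF assms(1,5)] by (simp add: S_def)
  have div: "\<And>x. x \<in> S \<Longrightarrow> discrete_div h u x = 0"
    using assms(9) by (simp add: S_def)
  have "grid_boundary h ?G \<subseteq> ?G"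
    by (auto simp: grid_boundary_def)
  \<comment> \<open>Extension by zero and the boundary condition together say exactly that
    \<open>v\<close> is supported in \<open>S\<close>.\<close>
  then have supp: "v \<in> grid_functions \<Omega> h \<and> (\<forall>x\<in>grid_boundary h ?G. v x = 0)
      \<longleftrightarrow> (\<forall>x. x \<notin> S \<longrightarrow> v x = 0)" for v :: "real^3 \<Rightarrow> real^3"
    by (auto simp: grid_functions_def S_def)
  have scheme: "(v x $ i - u x $ i) / \<tau> =
         - (\<Sum>j\<in>UNIV. (u (x - h *\<^sub>R axis j 1) $ j * D_plus h j (\<lambda>y. v y $ i) (x - h *\<^sub>R axis j 1)
                         + u x $ j * D_plus h j (\<lambda>y. v y $ i) x) / 2)
         + (\<Sum>j\<in>UNIV. D_second h j (\<lambda>y. v y $ i) x)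
         + averaged_force h \<tau> f n x $ i
      \<longleftrightarrow> step_operator h \<tau> u (\<lambda>y. v y $ i) x = b i x" for v :: "real^3 \<Rightarrow> real^3" and x i
    unfolding step_operator_def b_def diff_divide_distrib by linarith
  have "\<exists>!v :: real^3 \<Rightarrow> real^3. (\<forall>x. x \<notin> S \<longrightarrow> v x = 0)
      \<and> (\<forall>x\<in>S. \<forall>i. step_operator h \<tau> u (\<lambda>y. v y $ i) x = b i x)"
  proof (rule ex_ex1I)
    \<comment> \<open>The components decouple, so each is solved for separately and the three
      solutions are assembled into a vector field.\<close>
    have "\<exists>\<phi>. (\<forall>x. x \<notin> S \<longrightarrow> \<phi> x = 0) \<and> (\<forall>x\<in>S. step_operator h \<tau> u \<phi> x = b i x)" for i
      using step_operator_injective[OF fin _ assms(6) div]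
      by (intro linear_operator_solvable fin step_operator_add step_operator_scale) blast
    then obtain \<phi> where "\<And>i x. x \<notin> S \<Longrightarrow> \<phi> i x = 0"
      "\<And>i x. x \<in> S \<Longrightarrow> step_operator h \<tau> u (\<phi> i) x = b i x"
      by metis
    then show "\<exists>v :: real^3 \<Rightarrow> real^3. (\<forall>x. x \<notin> S \<longrightarrow> v x = 0)
        \<and> (\<forall>x\<in>S. \<forall>i. step_operator h \<tau> u (\<lambda>y. v y $ i) x = b i x)"
      by (intro exI[of _ "\<lambda>x. \<chi> i. \<phi> i x"]) (simp add: vec_eq_iff)
  next
    fix v w :: "real^3 \<Rightarrow> real^3"
    assume v: "(\<forall>x. x \<notin> S \<longrightarrow> v x = 0)
        \<and> (\<forall>x\<in>S. \<forall>i. step_operator h \<tau> u (\<lambda>y. v y $ i) x = b i x)"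
      and w: "(\<forall>x. x \<notin> S \<longrightarrow> w x = 0)
        \<and> (\<forall>x\<in>S. \<forall>i. step_operator h \<tau> u (\<lambda>y. w y $ i) x = b i x)"
    \<comment> \<open>Each component of the difference is supported in \<open>S\<close> and
      annihilated there by the operator.\<close>
    have "v x $ i - w x $ i = 0" for x i
      using v w
      by - (rule step_operator_injective[OF fin _ assms(6) div,
          where \<phi> = "\<lambda>y. v y $ i - w y $ i"], simp_all add: step_operator_diff)
    then show "v = w" by (simp add: fun_eq_iff vec_eq_iff)
  qed
  then show ?thesis
    unfolding scheme S_def[symmetric] supp[symmetric] by (simp add: conj_ac)
qed

end
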